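(* Let $G=(V,E,w)$ be a weighted hypergraph on vertices $v_1,\dots,v_N$, all of positive degree, whose maximum edge cardinality $\nabla$ is even. Suppose there are $n\ge2$ vertices of $G$ that are pairwise duplicate. Then $0$ is an eigenvalue of the adjacency tensor $A$ with Hspan multiplicity at least $n-1$, and $1$ is an eigenvalue of each of $L$, $L^+$, $\mathcal{L}$ and $\mathcal{L}^+$ with Hspan multiplicity at least $n-1$.
   Context: For a $k$-th order $n$-dimensional tensor $T$, $(\lambda,\mathbf{x})$ with $\mathbf{x}\ne0$ is an eigenpair if $\sum_{i_2,\ldots,i_k}T_{i,i_2,\ldots,i_k}x_{i_2}\cdots x_{i_k}=\lambda x_i^{k-1}$ for all $i$. For a real eigenvalue $\lambda$, its Hspan multiplicity is the dimension of the real vector space spanned by all eigenvectors of $\lambda$ lying in $\mathbb{R}^n$. Hypergraphs: $G=(V,E,w)$, $V=\{v_1,\dots,v_N\}$, edges are subsets of $V$ of size $\ge2$, $w:E\to\mathbb{R}_{>0}$, $\deg v=\sum_{e\ni v}w(e)$, $\nabla=\max|e|$, $E_r=\{e:|e|=r\}$, $N(r,k)=(r-1)!\cdot\frac{1}{r!}\sum_{j=0}^r(-1)^j\binom{r}{j}(r-j)^k$. All tensors are $\nabla$-th order $N$-dimensional. $A_{i_1,\ldots,i_\nabla}=w(e)/N(r,\nabla)$ if $\{v_{i_1},\ldots,v_{i_\nabla}\}=e\in E_r$, else $0$. $L$ / $L^+$: entries $1$ if $i_1=\dots=i_\nabla$, else $\mp A_{i_1,\ldots,i_\nabla}\prod_{j\in\{i_1,\ldots,i_\nabla\}}(\deg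 v_j)^{-1/\nabla}$ (product over distinct indices; minus for $L$, plus for $L^+$). $\mathcal L$ / $\mathcal L^+$: entries $1$ if $i_1=\dots=i_\nabla$, else $\mp A_{i_1,\ldots,i_\nabla}/\deg v_{i_1}$. Two vertices $v_i,v_j$ are duplicate if no edge contains both, and $A_{i,i_2,\ldots,i_\nabla}=A_{j,i_2,\ldots,i_\nabla}$ for all $i_2,\ldots,i_\nabla\in[N]$. *)

theory Defs
  imports "HOL-Analysis.Analysis"
begin

section \<open>Tensors and their eigenpairs\<close>

text \<open>A real tensor whose indices range over the finite type \<open>'n\<close> is a function on index lists
  \<open>[i\<^sub>1, \<dots>, i\<^sub>k]\<close>.  Its order \<open>k\<close> is passed explicitly; only the values on lists of
  length \<open>k\<close> are relevant.\<close>

type_synonym 'n tensor = "'n list \<Rightarrow> real"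

definition eigenpair :: "nat \<Rightarrow> 'n::finite tensor \<Rightarrow> complex \<Rightarrow> complex ^ 'n \<Rightarrow> bool" where
  "eigenpair k T \<mu> x \<longleftrightarrow>
     x \<noteq> 0 \<and>
     (\<forall>i. (\<Sum>js | length js = k - 1. complex_of_real (T (i # js)) * (\<Prod>j\<leftarrow>js. x $ j))
          = \<mu> * (x $ i) ^ (k - 1))"

definition eigenvalue :: "nat \<Rightarrow> 'n::finite tensor \<Rightarrow> complex \<Rightarrow> bool" where
  "eigenvalue k T \<mu> \<longleftrightarrow> (\<exists>x. eigenpair k T \<mu> x)"

text \<open>\<^const>\<open>dim\<close> of a set is the dimension of its real linear span.\<close>

definition hspan_multiplicity :: "nat \<Rightarrow> 'n::finite tensor \<Rightarrow> real \<Rightarrow> nat" where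
  "hspan_multiplicity k T \<mu> =
     dim {x :: real ^ 'n. eigenpair k T (complex_of_real \<mu>) (\<chi> i. complex_of_real (x $ i))}"

section \<open>Weighted hypergraphs\<close>

text \<open>The vertex set is the finite type \<open>'v\<close>, which also serves as the index set of the tensors.
  Values of \<open>w\<close> outside \<open>E\<close> are irrelevant.\<close>

locale weighted_hypergraph =
  fixes E :: "'v::finite set set" and w :: "'v set \<Rightarrow> real"
  assumes card_edge: "e \<in> E \<Longrightarrow> 2 \<le> card e"
    and weight_pos: "e \<in> E \<Longrightarrow> 0 < w e"

definition vdegree :: "'v::finite set set \<Rightarrow> ('v set \<Rightarrow> real) \<Rightarrow> 'v \<Rightarrow> real" where
  "vdegree E w v = (\<Sum>e | e \<in> E \<and> v \<in> e. w e)"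

text \<open>Only meaningful if \<open>E\<close> is nonempty, which holds whenever some vertex has positive degree.\<close>

definition max_edge_card :: "'v::finite set set \<Rightarrow> nat" where
  "max_edge_card E = Max (card ` E)"

text \<open>The number of index lists of length \<open>k\<close> with a prescribed first entry whose set of entries is a
  given \<open>r\<close>-element set containing that entry, i.e. \<open>(r - 1)!\<close> times a Stirling number of the second
  kind, the latter written out as an alternating sum.\<close>

definition edge_norm :: "nat \<Rightarrow> nat \<Rightarrow> real" where
  "edge_norm r k =
     fact (r - 1) * (1 / fact r * (\<Sum>j=0..r. (-1) ^ j * real (r choose j) * (real r - real j) ^ k))"

definition adjacency :: "'v::finite set set \<Rightarrow> ('v set \<Rightarrow> real) \<Rightarrow> 'v tensor" where
  "adjacency E w is =
     (if set is \<in> E then w (set is) / edge_norm (card (set is)) (max_edge_card E) else 0)"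

definition all_equal :: "'v list \<Rightarrow> bool" where
  "all_equal is \<longleftrightarrow> (\<forall>i\<in>set is. \<forall>j\<in>set is. i = j)"

definition sym_laplacian :: "'v::finite set set \<Rightarrow> ('v set \<Rightarrow> real) \<Rightarrow> 'v tensor" where
  "sym_laplacian E w is =
     (if all_equal is then 1
      else - (adjacency E w is
              * (\<Prod>j\<in>set is. vdegree E w j powr (- 1 / real (max_edge_card E)))))"

definition signless_sym_laplacian :: "'v::finite set set \<Rightarrow> ('v set \<Rightarrow> real) \<Rightarrow> 'v tensor" where
  "signless_sym_laplacian E w is =
     (if all_equal is then 1
      else adjacency E w is
           * (\<Prod>j\<in>set is. vdegree E w j powr (- 1 / real (max_edge_card E))))"

definition rw_laplacian :: "'v::finite set set \<Rightarrow> ('v set \<Rightarrow> real) \<Rightarrow> 'v tensor" where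
  "rw_laplacian E w is =
     (if all_equal is then 1 else - (adjacency E w is / vdegree E w (hd is)))"

definition signless_rw_laplacian :: "'v::finite set set \<Rightarrow> ('v set \<Rightarrow> real) \<Rightarrow> 'v tensor" where
  "signless_rw_laplacian E w is =
     (if all_equal is then 1 else adjacency E w is / vdegree E w (hd is))"

definition duplicate :: "'v::finite set set \<Rightarrow> ('v set \<Rightarrow> real) \<Rightarrow> 'v \<Rightarrow> 'v \<Rightarrow> bool" where
  "duplicate E w u v \<longleftrightarrow>
     \<not> (\<exists>e\<in>E. u \<in> e \<and> v \<in> e) \<and>
     (\<forall>is. length is = max_edge_card E - 1 \<longrightarrow> adjacency E w (u # is) = adjacency E w (v # is))"

end

theory Submission
  imports Defs
begin

text \<open>For duplicate vertices \<open>u\<close>, \<open>v\<close> the vector \<open>x = axis u 1 - axis v 1\<close> is an eigenvector of all five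
  tensors.  No edge contains both \<open>u\<close> and \<open>v\<close>, so in row \<open>i\<close> only the monomials
  \<open>x\<^sub>u\<^sup>k\<^sup>-\<^sup>1 = 1\<close> and \<open>x\<^sub>v\<^sup>k\<^sup>-\<^sup>1 = -1\<close> contribute off the diagonal, with coefficients supported on the
  pairs \<open>{i, u}\<close> and \<open>{i, v}\<close>.  If \<open>k > 2\<close> these pairs are not edges, since otherwise
  \<open>A(u, i, u, \<dots>, u) \<noteq> 0 = A(v, i, u, \<dots>, u)\<close>; if \<open>k = 2\<close> the two coefficients agree and cancel.  Fixing
  one vertex of \<open>S\<close> and varying the other yields \<open>n - 1\<close> linearly independent such vectors.\<close>

section \<open>Real eigenpairs and differences of axis vectors\<close>

text \<open>The embedding of the reals is an injective ring homomorphism, so for a real vector the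
  eigenvalue equations can be checked over the reals.\<close>

lemma eigenpair_of_real_iff:
  fixes x :: "real ^ 'n::finite"
  shows "eigenpair k T (complex_of_real \<mu>) (\<chi> i. complex_of_real (x $ i)) \<longleftrightarrow>
    x \<noteq> 0 \<and> (\<forall>i. (\<Sum>js | length js = k - 1. T (i # js) * (\<Prod>j\<leftarrow>js. x $ j)) = \<mu> * (x $ i) ^ (k - 1))"
proof -
  have prod: "(\<Prod>j\<leftarrow>js. complex_of_real (x $ j)) = complex_of_real (\<Prod>j\<leftarrow>js. x $ j)" for js
    by (induction js) auto
  have "(\<chi> i. complex_of_real (x $ i)) = 0 \<longleftrightarrow> x = 0"
    by (simp add: vec_eq_iff)
  moreover have "(\<Sum>js | length js = k - 1. complex_of_real (T (i # js)) * (\<Prod>j\<leftarrow>js. complex_of_real (x $ j)))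
      = complex_of_real (\<Sum>js | length js = k - 1. T (i # js) * (\<Prod>j\<leftarrow>js. x $ j))" for i
    by (simp add: prod)
  moreover have "complex_of_real \<mu> * complex_of_real (x $ i) ^ (k - 1) = complex_of_real (\<mu> * (x $ i) ^ (k - 1))" for i
    by simp
  ultimately show ?thesis
    unfolding eigenpair_def vec_lambda_beta by (simp only: of_real_eq_iff)
qed

lemma finite_lists_of_length: "finite {js :: 'a::finite list. length js = m}"
  using finite_lists_length_eq[of "UNIV :: 'a set" m] by simp

lemma all_equal_Cons_iff: "all_equal (i # js) \<longleftrightarrow> js = replicate (length js) i"
proof
  assume "all_equal (i # js)"
  then have "\<forall>j\<in>set js. j = i"
    unfolding all_equal_def by auto
  then show "js = replicate (length js) i"
    by (simp add: replicate_length_same)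
next
  assume "js = replicate (length js) i"
  then have "set js \<subseteq> {i}"
    by (metis singleton_iff subsetI in_set_replicate)
  then show "all_equal (i # js)"
    unfolding all_equal_def by auto
qed

lemma independent_axis: "independent ((\<lambda>v. axis v (1::real)) ` (S :: 'n::finite set))"
  by (rule independent_mono[OF independent_Basis]) (auto simp: axis_in_Basis_iff)

text \<open>Affine independence turns independence of the axis vectors over \<open>S\<close> into
  independence of their differences from \<open>axis s 1\<close>, of which there are
  \<open>card S - 1\<close>.\<close>

lemma card_le_dim_axis_differences:
  fixes S :: "'n::finite set" and V :: "(real ^ 'n) set"
  assumes s: "s \<in> S" and sub: "\<And>v. v \<in> S \<Longrightarrow> v \<noteq> s \<Longrightarrow> axis v 1 - axis s 1 \<in> V"
  shows "card S - 1 \<le> dim V"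
proof -
  let ?a = "\<lambda>v. axis v (1::real) :: real ^ 'n"
  have inj: "inj ?a"
    by (auto intro!: injI simp: axis_eq_axis)
  let ?B = "(\<lambda>x. - ?a s + x) ` ?a ` (S - {s})"
  have "?a ` S = insert (?a s) (?a ` (S - {s}))"
    using s by auto
  then have "\<not> affine_dependent (insert (?a s) (?a ` (S - {s})))"
    using independent_axis[of S] affine_dependent_imp_dependent by metis
  moreover have "?a s \<notin> ?a ` (S - {s})"
    using inj by (auto dest: injD)
  ultimately have "independent ?B"
    using affine_dependent_iff_dependent by metis
  moreover have "?B \<subseteq> V"
    using sub by auto
  ultimately have "card ?B \<le> dim V"
    by (simp add: independent_card_le_dim)
  moreover have "card ?B = card S - 1"
    using s by (simp add: card_image inj_on_def axis_eq_axis card_Diff_singleton)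
  ultimately show ?thesis
    by simp
qed

section \<open>Edges and degrees at duplicate vertices\<close>

lemma edge_norm_2: "0 < k \<Longrightarrow> edge_norm 2 k = (2 ^ k - 2) / 2"
  \<comment> \<open>The alternating sum is \<open>2 ^ k - 2 + 0 ^ k\<close>, whose last term
    vanishes because \<open>0 < k\<close>.\<close>
  by (simp add: edge_norm_def numeral_2_eq_2)

lemma duplicate_no_common_edge: "duplicate E w u v \<Longrightarrow> e \<in> E \<Longrightarrow> u \<in> e \<Longrightarrow> v \<notin> e"
  unfolding duplicate_def by blast

lemma duplicate_sym: "duplicate E w u v \<Longrightarrow> duplicate E w v u"
  unfolding duplicate_def by auto

lemma card_le_max_edge_card:
  fixes E :: "'v::finite set set"
  shows "e \<in> E \<Longrightarrow> card e \<le> max_edge_card E"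
  unfolding max_edge_card_def by (intro Max_ge) auto

context weighted_hypergraph
begin

abbreviation "k \<equiv> max_edge_card E"

lemma max_edge_card_ge_2: "E \<noteq> {} \<Longrightarrow> 2 \<le> k"
  using card_edge card_le_max_edge_card by (meson all_not_in_conv order_trans)

lemma singleton_not_edge: "{a} \<notin> E"
  using card_edge by fastforce

text \<open>Edges have at least two vertices, so a tensor supported on edges is zero on the
  diagonal.\<close>

lemma all_equal_not_edge: "set is \<in> E \<Longrightarrow> \<not> all_equal is"
proof
  assume "set is \<in> E" "all_equal is"
  moreover have "card (set is) \<le> 1"
    using \<open>all_equal is\<close> unfolding all_equal_def by (auto simp: card_le_Suc0_iff_eq)
  ultimately show False
    using card_edge by fastforce
qed

lemma duplicate_pair_not_edge:
  assumes dup: "duplicate E w u v" and "2 < k"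
  shows "{i, u} \<notin> E"
proof
  assume e: "{i, u} \<in> E"
  then have "card {i, u} = 2"
    using card_edge by (metis card_2_iff doubleton_eq_iff insert_absorb2 singleton_not_edge)
  \<comment> \<open>As \<open>k > 2\<close>, the tail still contains \<open>u\<close>, so
    \<open>v # ?js\<close> has both \<open>u\<close> and \<open>v\<close> among its entries, whereas
    \<open>u # ?js\<close> has entry set \<open>{i, u}\<close>.\<close>
  let ?js = "i # replicate (k - 2) u"
  have "length ?js = k - 1"
    using \<open>2 < k\<close> by simp
  then have "adjacency E w (u # ?js) = adjacency E w (v # ?js)"
    using dup unfolding duplicate_def by blast
  also have "\<dots> = 0"
    using duplicate_no_common_edge[OF dup] \<open>2 < k\<close> by (auto simp: adjacency_def)
  finally have "w {i, u} / edge_norm 2 k = 0"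
    using e \<open>card {i, u} = 2\<close> \<open>2 < k\<close> by (simp add: adjacency_def insert_commute)
  \<comment> \<open>This makes \<open>edge_norm 2 k\<close> nonzero, which matters since division by
    zero yields 0.\<close>
  moreover have "(2::real) ^ 1 < 2 ^ k"
    using \<open>2 < k\<close> by (intro power_strict_increasing) auto
  ultimately show False
    using weight_pos[OF e] \<open>2 < k\<close> by (simp add: edge_norm_2)
qed

text \<open>For \<open>k = 2\<close> every edge is a pair and \<open>edge_norm 2 2 = 1\<close>, so
  degrees are row sums of the adjacency matrix, and duplicate vertices have equal rows.\<close>

lemma duplicate_vdegree_eq:
  assumes dup: "duplicate E w u v" and k: "k = 2"
  shows "vdegree E w u = vdegree E w v"
proof -
  have "vdegree E w a = (\<Sum>j\<in>UNIV. adjacency E w [a, j])" for a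
  proof -
    have adj: "adjacency E w [a, j] = (if {a, j} \<in> E then w {a, j} else 0)" for j
    proof (cases "{a, j} \<in> E")
      case True
      then have "card {a, j} = 2"
        using card_edge card_le_max_edge_card k by (metis le_antisym)
      then show ?thesis
        using True k by (simp add: adjacency_def edge_norm_2)
    qed (simp add: adjacency_def)
    have "{e \<in> E. a \<in> e} = (\<lambda>j. {a, j}) ` {j. {a, j} \<in> E}"
    proof (intro equalityI subsetI)
      fix e assume "e \<in> {e \<in> E. a \<in> e}"
      moreover from this have "card e = 2"
        using card_edge card_le_max_edge_card k by (metis (mono_tags) le_antisym mem_Collect_eq)
      ultimately show "e \<in> (\<lambda>j. {a, j}) ` {j. {a, j} \<in> E}"
        by (auto simp: card_2_iff insert_commute)
    qed auto
    then have "vdegree E w a = (\<Sum>j | {a, j} \<in> E. w {a, j})"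
      unfolding vdegree_def by (simp add: sum.reindex inj_on_def doubleton_eq_iff)
    then show ?thesis
      by (simp add: adj sum.If_cases)
  qed
  moreover have "adjacency E w [u, j] = adjacency E w [v, j]" for j
    using dup k unfolding duplicate_def by simp
  ultimately show ?thesis
    by simp
qed

section \<open>Eigenvectors from duplicate vertices\<close>

text \<open>One computation serves all five tensors: \<open>B\<close> is the adjacency tensor or a
  rescaled version of it up to sign, and the diagonal value \<open>c\<close> is 0 or 1.\<close>

lemma duplicate_eigenpair:
  assumes dup: "duplicate E w u v" and "u \<noteq> v" and "even k" and "2 \<le> k"
    and supp: "\<And>is. set is \<notin> E \<Longrightarrow> B is = 0"
    and cancel: "\<And>i. k = 2 \<Longrightarrow> B [i, u] = B [i, v]"
    and T: "\<And>is. T is = (if all_equal is then c else B is)"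
  defines "x \<equiv> axis u 1 - axis v 1 :: real ^ 'v"
  shows "eigenpair k T (complex_of_real c) (\<chi> i. complex_of_real (x $ i))"
  unfolding eigenpair_of_real_iff
proof (intro conjI allI)
  show "x \<noteq> 0"
    using \<open>u \<noteq> v\<close> by (simp add: x_def axis_eq_axis)
next
  fix i
  let ?J = "{js :: 'v list. length js = k - 1}"
  let ?P = "\<lambda>js. \<Prod>j\<leftarrow>js. x $ j"
  let ?r = "replicate (k - 1)"
  have xu: "x $ u = 1" and xv: "x $ v = -1" and x0: "\<And>j. j \<noteq> u \<Longrightarrow> j \<noteq> v \<Longrightarrow> x $ j = 0"
    using \<open>u \<noteq> v\<close> by (auto simp: x_def axis_def)
  have odd: "odd (k - 1)" and pos: "0 < k - 1"
    using \<open>even k\<close> \<open>2 \<le> k\<close> by auto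
  have P_rep: "?P (?r j) = x $ j ^ (k - 1)" for j
    by (simp add: prod_list_replicate)
  have other: "B (i # js) * ?P js = 0" if js: "js \<in> ?J - {?r u, ?r v}" for js
  proof (cases "set js \<subseteq> {u, v}")
    case True
    \<comment> \<open>\<open>js\<close> is not constant, so it contains both \<open>u\<close> and
      \<open>v\<close>, which no edge does.\<close>
    have "u \<in> set js" "v \<in> set js"
      using True js replicate_length_same[of js u] replicate_length_same[of js v] by auto
    then show ?thesis
      using supp[of "i # js"] duplicate_no_common_edge[OF dup, of "set (i # js)"] by auto
  next
    case False
    then have "?P js = 0"
      using x0 by (force simp: prod_list_zero_iff)
    then show ?thesis
      by simp
  qed
  have pair: "B (i # ?r u) = B (i # ?r v)"
  proof (cases "k = 2")
    case True
    then show ?thesis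
      using cancel by simp
  next
    case False
    then have "{i, u} \<notin> E" "{i, v} \<notin> E"
      using duplicate_pair_not_edge dup duplicate_sym \<open>2 \<le> k\<close> by (metis le_neq_implies_less)+
    then show ?thesis
      using supp pos by simp
  qed
  have "(\<Sum>js\<in>?J. B (i # js) * ?P js) = (\<Sum>js\<in>{?r u, ?r v}. B (i # js) * ?P js)"
    using other by (intro sum.mono_neutral_right finite_lists_of_length) auto
  \<comment> \<open>\<open>0 < k - 1\<close> keeps the two constant lists distinct.\<close>
  also have "\<dots> = B (i # ?r u) * ?P (?r u) + B (i # ?r v) * ?P (?r v)"
    using \<open>u \<noteq> v\<close> pos by (simp add: replicate_eq_replicate)
  \<comment> \<open>The coefficients agree by \<open>pair\<close>, and since \<open>k\<close> is
    even the two monomials are 1 and \<open>(-1) ^ (k - 1) = -1\<close>.\<close>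
  also have "\<dots> = 0"
    using odd by (simp only: P_rep xu xv pair) simp
  finally have B0: "(\<Sum>js\<in>?J. B (i # js) * ?P js) = 0" .
  \<comment> \<open>\<open>B\<close> vanishes on constant lists, so \<open>T\<close> splits as
    \<open>c\<close> times the identity tensor plus \<open>B\<close>.\<close>
  have "T (i # js) * ?P js = (if js = ?r i then c * ?P js else 0) + B (i # js) * ?P js"
    if "js \<in> ?J" for js
    using that supp[of "i # js"] all_equal_not_edge[of "i # js"] all_equal_Cons_iff[of i js] T
    by (cases "all_equal (i # js)") auto
  then have "(\<Sum>js\<in>?J. T (i # js) * ?P js)
      = (\<Sum>js\<in>?J. (if js = ?r i then c * ?P js else 0) + B (i # js) * ?P js)"
    by (intro sum.cong) auto
  also have "\<dots> = c * ?P (?r i)"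
    unfolding sum.distrib B0 by (simp add: finite_lists_of_length)
  finally show "(\<Sum>js\<in>?J. T (i # js) * ?P js) = c * x $ i ^ (k - 1)"
    by (simp only: P_rep)
qed

lemma pairwise_duplicate_hspan_multiplicity:
  assumes "even k" and "2 \<le> k" and "2 \<le> card S"
    and dup: "\<And>u v. u \<in> S \<Longrightarrow> v \<in> S \<Longrightarrow> u \<noteq> v \<Longrightarrow> duplicate E w u v"
    and "\<And>is. set is \<notin> E \<Longrightarrow> B is = 0"
    and "\<And>i u v. k = 2 \<Longrightarrow> duplicate E w u v \<Longrightarrow> B [i, u] = B [i, v]"
    and "\<And>is. T is = (if all_equal is then c else B is)"
  shows "eigenvalue k T (complex_of_real c) \<and> card S - 1 \<le> hspan_multiplicity k T c"
proof -
  have eig: "eigenpair k T (complex_of_real c) (\<chi> i. complex_of_real ((axis u 1 - axis v 1) $ i))"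
    if "u \<in> S" "v \<in> S" "u \<noteq> v" for u v
    using assms that by (intro duplicate_eigenpair[where B = B]) auto
  obtain s where s: "s \<in> S"
    using \<open>2 \<le> card S\<close> by fastforce
  moreover have "S \<noteq> {s}"
    using \<open>2 \<le> card S\<close> by auto
  ultimately obtain t where "t \<in> S" "t \<noteq> s"
    by blast
  then have "eigenvalue k T (complex_of_real c)"
    using eig s unfolding eigenvalue_def by blast
  moreover have "card S - 1 \<le> hspan_multiplicity k T c"
    unfolding hspan_multiplicity_def using s eig by (intro card_le_dim_axis_differences) auto
  ultimately show ?thesis ..
qed

section \<open>Columns at duplicate vertices and the five tensors\<close>

text \<open>Adjacency entries depend only on the set of indices; for \<open>k = 2\<close> this
  symmetry turns the equal rows of duplicate vertices into equal columns.\<close>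

lemma adjacency_duplicate_cols:
  assumes "k = 2" and "duplicate E w u v"
  shows "adjacency E w [i, u] = adjacency E w [i, v]"
proof -
  have "adjacency E w [u, i] = adjacency E w [v, i]"
    using assms unfolding duplicate_def by simp
  moreover have "adjacency E w [a, b] = adjacency E w [b, a]" for a b
    unfolding adjacency_def by (simp add: insert_commute)
  ultimately show ?thesis
    by metis
qed

text \<open>\<open>f\<close> stands for the degree factor of the symmetric Laplacians. The product
  over distinct indices collapses when \<open>i\<close> is \<open>u\<close> or \<open>v\<close>, but
  then one of the two adjacency entries lies on the diagonal and vanishes, and equality of columns
  makes the other vanish too.\<close>

lemma scaled_adjacency_duplicate_cols:
  assumes "k = 2" and dup: "duplicate E w u v" and f: "f u = f v"
  shows "adjacency E w [i, u] * (\<Prod>j\<in>set [i, u]. f j) = adjacency E w [i, v] * (\<Prod>j\<in>set [i, v]. f j)"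
proof (cases "i = u \<or> i = v")
  case True
  then have "adjacency E w [i, u] = 0 \<or> adjacency E w [i, v] = 0"
    using singleton_not_edge by (auto simp: adjacency_def)
  then show ?thesis
    using adjacency_duplicate_cols[OF assms(1,2), of i] by auto
next
  case False
  then show ?thesis
    using adjacency_duplicate_cols[OF assms(1,2), of i] f by simp
qed

end

theorem theorem4p2:
  fixes E :: "'v::finite set set" and w :: "'v set \<Rightarrow> real" and S :: "'v set" and n :: nat
  assumes "weighted_hypergraph E w"
    and "\<And>v. 0 < vdegree E w v"
    and "even (max_edge_card E)"
    and "n \<ge> 2"
    and "card S = n"
    and "\<And>u v. u \<in> S \<Longrightarrow> v \<in> S \<Longrightarrow> u \<noteq> v \<Longrightarrow> duplicate E w u v"
  shows "(eigenvalue (max_edge_card E) (adjacency E w) 0 \<and>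
          hspan_multiplicity (max_edge_card E) (adjacency E w) 0 \<ge> n - 1) \<and>
         (\<forall>T \<in> {sym_laplacian E w, signless_sym_laplacian E w,
                 rw_laplacian E w, signless_rw_laplacian E w}.
            eigenvalue (max_edge_card E) T 1 \<and>
            hspan_multiplicity (max_edge_card E) T 1 \<ge> n - 1)"
proof -
  interpret weighted_hypergraph E w
    by fact
  have supp: "adjacency E w is = 0" if "set is \<notin> E" for "is"
    using that by (simp add: adjacency_def)
  let ?f = "\<lambda>j. vdegree E w j powr (- 1 / real (max_edge_card E))"
  \<comment> \<open>Without edges every degree would be an empty sum, contradicting
    positivity.\<close>
  have "E \<noteq> {}"
    using assms(2) unfolding vdegree_def by force
  then have k: "2 \<le> max_edge_card E"
    by (rule max_edge_card_ge_2)
  have mult: "eigenvalue (max_edge_card E) T (complex_of_real c) \<and>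
      n - 1 \<le> hspan_multiplicity (max_edge_card E) T c"
    if "\<And>is. set is \<notin> E \<Longrightarrow> B is = 0"
      and "\<And>i u v. max_edge_card E = 2 \<Longrightarrow> duplicate E w u v \<Longrightarrow> B [i, u] = B [i, v]"
      and "\<And>is. T is = (if all_equal is then c else B is)" for B T c
    using pairwise_duplicate_hspan_multiplicity[OF assms(3) k, of S B T c] assms(4-6) that by simp
  have f: "?f u = ?f v" if "max_edge_card E = 2" "duplicate E w u v" for u v
    using duplicate_vdegree_eq that by simp
  have cols: "adjacency E w [i, u] = adjacency E w [i, v]"
    if "max_edge_card E = 2" "duplicate E w u v" for i u v
    using adjacency_duplicate_cols that .
  have scaled: "adjacency E w [i, u] * (\<Prod>j\<in>set [i, u]. ?f j) = adjacency E w [i, v] * (\<Prod>j\<in>set [i, v]. ?f j)"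
    if "max_edge_card E = 2" "duplicate E w u v" for i u v
    using scaled_adjacency_duplicate_cols[OF that, of ?f] f[OF that] .
  \<comment> \<open>The adjacency tensor is zero on the diagonal, hence fits the scheme with
    \<open>c = 0\<close>.\<close>
  have "eigenvalue (max_edge_card E) (adjacency E w) (complex_of_real 0) \<and>
      n - 1 \<le> hspan_multiplicity (max_edge_card E) (adjacency E w) 0"
    by (rule mult[where B = "adjacency E w"])
      (use supp cols all_equal_not_edge in metis)+
  moreover have "eigenvalue (max_edge_card E) (sym_laplacian E w) (complex_of_real 1) \<and>
      n - 1 \<le> hspan_multiplicity (max_edge_card E) (sym_laplacian E w) 1"
    by (rule mult[where B = "\<lambda>is. - (adjacency E w is * (\<Prod>j\<in>set is. ?f j))"])
      (simp add: supp, metis scaled, simp only: sym_laplacian_def)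
  moreover have "eigenvalue (max_edge_card E) (signless_sym_laplacian E w) (complex_of_real 1) \<and>
      n - 1 \<le> hspan_multiplicity (max_edge_card E) (signless_sym_laplacian E w) 1"
    by (rule mult[where B = "\<lambda>is. adjacency E w is * (\<Prod>j\<in>set is. ?f j)"])
      (simp add: supp, metis scaled, simp only: signless_sym_laplacian_def)
  \<comment> \<open>The degree factor depends on the first index only, so it is the same in both
    columns and their equality carries over.\<close>
  moreover have "eigenvalue (max_edge_card E) (rw_laplacian E w) (complex_of_real 1) \<and>
      n - 1 \<le> hspan_multiplicity (max_edge_card E) (rw_laplacian E w) 1"
    by (rule mult[where B = "\<lambda>is. - (adjacency E w is / vdegree E w (hd is))"])
      (simp add: supp, metis cols list.sel(1), simp only: rw_laplacian_def)
  moreover have "eigenvalue (max_edge_card E) (signless_rw_laplacian E w) (complex_of_real 1) \<and>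
      n - 1 \<le> hspan_multiplicity (max_edge_card E) (signless_rw_laplacian E w) 1"
    by (rule mult[where B = "\<lambda>is. adjacency E w is / vdegree E w (hd is)"])
      (simp add: supp, metis cols list.sel(1), simp only: signless_rw_laplacian_def)
  ultimately show ?thesis
    by simp
qed

end
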